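(* Let $\mathcal{V}$, $x$, $v$, $\tilde v$, $\mathcal{V}_+$, $\tilde{\mathcal{V}}_+$ and $\tilde\varepsilon$ be as in the context, let $x_\perp=(I-P_V)x$, and assume $\sin\angle(v,x_\perp)\neq0$. Then $$\sin\angle(\mathcal{V}_+,x)=\sin\angle(\mathcal{V},x)\,\sin\angle(v,x_\perp),$$ $$\frac{\sin\angle(\tilde{\mathcal{V}}_+,x)}{\sin\angle(\mathcal{V}_+,x)}=\frac{\sin\angle(\tilde v,x_\perp)}{\sin\angle(v,x_\perp)}.$$ Suppose moreover that $\angle(\tilde v,v)$ is acute. If $\tau=\frac{2\tilde\varepsilon}{\sin\angle(v,x_\perp)}<1$, then $$1-\tau\le\frac{\sin\angle(\tilde{\mathcal{V}}_+,x)}{\sin\angle(\mathcal{V}_+,x)}\le1+\tau .$$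
   Context: $\|\cdot\|$ is the 2-norm, $H$ denotes conjugate transpose. For a nonzero vector $w$ and a subspace $\mathcal{W}$ of $\mathbb{C}^n$ with orthogonal projector $P_{\mathcal{W}}$, $\sin\angle(\mathcal{W},w)=\|(I-P_{\mathcal{W}})w\|/\|w\|$; for nonzero vectors, $\sin\angle(a,b)=\sin\angle(\mathrm{span}\{a\},b)$, with $\angle(a,b)\in[0,\pi/2]$; acute means $<\pi/2$. $A\in\mathbb{C}^{n\times n}$ has eigenvalues labeled so that $0<|\lambda_1-\sigma|<|\lambda_2-\sigma|\le\cdots\le|\lambda_n-\sigma|$ for a given target $\sigma\in\mathbb{C}$; $(\lambda,x)=(\lambda_1,x_1)$ is the desired (simple) eigenpair, $\|x\|=1$, and $B=(A-\sigma I)^{-1}$. $\mathcal{V}$ is the current subspace, $V$ a matrix whose columns form an orthonormal basis of it, and $P_V$ the orthogonal projector onto $\mathcal{V}$. The current approximate eigenpair is $(\nu,y)$ with $y=Vz$, where $(\nu,z)$ is an eigenpair of $V^HAV$ and $\|z\|=1$; so $y\in\mathcal{V}$ and $\|y\|=1$. The inner linear system is $(A-\sigma I)u=\alpha_1y+\alpha_2(A-\sigma I)y$ with $\alpha_1\neq0$, whose exact solution is $u=\alpha_1By+\alpha_2y$; SIRA uses $\alpha_1=\sigma-\nu$, $\alpha_2=1$, and JD with fixed target uses $\alpha_1=-1/(y^HBy)$, $\alpha_2=1$. Let $\tilde u$ be an approximate solution of this system, and assume $(I-P_V)u\ne0$, $(I-P_V)\tilde u\neq0$. The normalized subspace expansion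 vectors of the exact and inexact methods are $$v=\frac{(I-P_V)u}{\|(I-P_V)u\|},\qquad \tilde v=\frac{(I-P_V)\tilde u}{\|(I-P_V)\tilde u\|},$$ and $$\tilde\varepsilon=\frac{\|(I-P_V)\tilde u-(I-P_V)u\|}{\|(I-P_V)u\|}.$$ The expanded subspaces are $\mathcal{V}_+=\mathrm{span}\{[V\ \ v]\}$ and $\tilde{\mathcal{V}}_+=\mathrm{span}\{[V\ \ \tilde v]\}$ (column spans). It is assumed that $x_\perp=(I-P_V)x\neq0$, so the angles with $x_\perp$ are defined. *)

theory Defs
  imports "HOL-Analysis.Analysis"
begin

text \<open>On \<open>complex ^ 'n\<close> the library's \<open>norm\<close> is the Hermitian 2-norm, but \<open>span\<close> and \<open>subspace\<close>
  are the real-linear notions and \<open>a \<bullet> b\<close> is only the real part of the Hermitian product.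
  Complex subspaces are therefore expressed with \<open>vec.span\<close> and \<open>vec.subspace\<close>.\<close>

definition conj_transpose :: "complex ^ 'n ^ 'm \<Rightarrow> complex ^ 'm ^ 'n" where
  "conj_transpose M = (\<chi> i j. cnj (M $ j $ i))"

definition eigenpair :: "complex ^ 'n ^ 'n \<Rightarrow> complex \<Rightarrow> complex ^ 'n \<Rightarrow> bool" where
  "eigenpair M l w \<longleftrightarrow> w \<noteq> 0 \<and> M *v w = l *s w"

text \<open>\<open>lam 1, \<dots>, lam n\<close> are the eigenvalues of \<open>M\<close>, listed with algebraic multiplicity.\<close>

definition eigenvalue_list :: "complex ^ 'n ^ 'n \<Rightarrow> (nat \<Rightarrow> complex) \<Rightarrow> bool" where
  "eigenvalue_list M lam \<longleftrightarrow> (\<forall>t. det (mat t - M) = (\<Prod>k = 1..CARD('n). t - lam k))"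

definition orth_projector :: "complex ^ 'n ^ 'n \<Rightarrow> (complex ^ 'n) set \<Rightarrow> bool" where
  "orth_projector P W \<longleftrightarrow> P ** P = P \<and> conj_transpose P = P \<and> range ((*v) P) = W"

definition proj :: "(complex ^ 'n) set \<Rightarrow> complex ^ 'n ^ 'n" where
  "proj W = (THE P. orth_projector P W)"

definition sin_angle_sub :: "(complex ^ 'n) set \<Rightarrow> complex ^ 'n \<Rightarrow> real" where
  "sin_angle_sub W w = norm ((mat 1 - proj W) *v w) / norm w"

definition sin_angle :: "complex ^ 'n \<Rightarrow> complex ^ 'n \<Rightarrow> real" where
  "sin_angle a b = sin_angle_sub (vec.span {a}) b"

definition angle :: "complex ^ 'n \<Rightarrow> complex ^ 'n \<Rightarrow> real" where
  "angle a b = arcsin (sin_angle a b)"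

text \<open>The projector onto a complex subspace exists and is unique, so \<open>proj\<close> is well defined there.\<close>

lemma inner_smult_left:
  fixes a b :: "complex ^ 'n"
  shows "(c *s a) \<bullet> b = a \<bullet> (cnj c *s b)"
  by (simp add: inner_vec_def inner_complex_def algebra_simps)

lemma inner_conj_transpose:
  fixes M :: "complex ^ 'n ^ 'm"
  shows "(conj_transpose M *v a) \<bullet> b = a \<bullet> (M *v b)"
proof -
  have c: "x \<bullet> y = Re (cnj x * y)" for x y :: complex
    by (simp add: inner_complex_def)
  have "(conj_transpose M *v a) \<bullet> b = Re (\<Sum>i\<in>UNIV. \<Sum>j\<in>UNIV. M $ j $ i * cnj (a $ j) * b $ i)"
    by (simp add: inner_vec_def c conj_transpose_def matrix_vector_mult_def sum_distrib_right
        del: times_complex.sel)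
  also have "(\<Sum>i\<in>UNIV. \<Sum>j\<in>UNIV. M $ j $ i * cnj (a $ j) * b $ i)
      = (\<Sum>j\<in>UNIV. \<Sum>i\<in>UNIV. cnj (a $ j) * (M $ j $ i * b $ i))"
    by (subst sum.swap) (simp add: mult_ac)
  also have "Re \<dots> = a \<bullet> (M *v b)"
    by (simp add: inner_vec_def c matrix_vector_mult_def sum_distrib_left
        del: times_complex.sel)
  finally show ?thesis .
qed

lemma orth_projector_unique:
  assumes "orth_projector P W" "orth_projector Q W"
  shows "P = Q"
proof -
  have absorb: "Q' *v (P' *v w) = P' *v w" if "orth_projector P' W" "orth_projector Q' W" for P' Q' w
  proof -
    have "P' *v w \<in> range ((*v) Q')"
      using that unfolding orth_projector_def by blast
    then obtain w' where "P' *v w = Q' *v w'" by auto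
    then show ?thesis
      using that unfolding orth_projector_def by (metis matrix_vector_mul_assoc)
  qed
  have adj: "(P' *v a) \<bullet> b = a \<bullet> (P' *v b)" if "orth_projector P' W" for P' a b
    using that inner_conj_transpose[of P' a b] unfolding orth_projector_def by simp
  have "(P *v a) \<bullet> b = (Q *v a) \<bullet> b" for a b
  proof -
    have "(P *v a) \<bullet> b = (Q *v (P *v a)) \<bullet> b" using absorb[OF assms] by simp
    also have "\<dots> = a \<bullet> (P *v (Q *v b))" using adj[OF assms(1)] adj[OF assms(2)] by simp
    also have "\<dots> = a \<bullet> (Q *v b)" using absorb[OF assms(2,1)] by simp
    also have "\<dots> = (Q *v a) \<bullet> b" using adj[OF assms(2)] by simp
    finally show ?thesis .
  qed
  then have "P *v a = Q *v a" for a
    by (metis vector_eq_rdot)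
  then show ?thesis by (simp add: matrix_eq)
qed

lemma orth_projector_exists:
  fixes W :: "(complex ^ 'n) set"
  assumes W: "vec.subspace W"
  shows "\<exists>P. orth_projector P W"
proof -
  have scale: "r *\<^sub>R w = complex_of_real r *s w" for r and w :: "complex ^ 'n"
    by (simp add: vec_eq_iff complex_eq_iff)
  have "subspace W"
    using W unfolding subspace_def vec.subspace_def by (simp add: scale)
  then have sp: "span W = W" by simp
  have "\<exists>p\<in>W. \<forall>w\<in>W. (a - p) \<bullet> w = 0" for a
  proof -
    obtain p q where "p \<in> span W" "\<And>w. w \<in> span W \<Longrightarrow> orthogonal q w" "a = p + q"
      using orthogonal_subspace_decomp_exists by blast
    then show ?thesis
      by (intro bexI[of _ p]) (simp_all add: sp orthogonal_def)
  qed
  then obtain f where fW: "f a \<in> W" and fo: "\<And>w. w \<in> W \<Longrightarrow> (a - f a) \<bullet> w = 0" for a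
    by metis
  have funiq: "f a = p" if "p \<in> W" "\<And>w. w \<in> W \<Longrightarrow> (a - p) \<bullet> w = 0" for a p
  proof -
    have d: "f a - p \<in> W" using that(1) fW W vec.subspace_diff by blast
    have "(f a - p) \<bullet> (f a - p) = (a - p) \<bullet> (f a - p) - (a - f a) \<bullet> (f a - p)"
      by (simp add: inner_diff_left)
    also have "\<dots> = 0" using that(2)[OF d] fo[OF d] by simp
    finally show ?thesis by simp
  qed
  have lin: "Vector_Spaces.linear (*s) (*s) f"
  proof unfold_locales
    fix a b
    show "f (a + b) = f a + f b"
    proof (rule funiq)
      show "f a + f b \<in> W" using W fW vec.subspace_add by blast
      show "(a + b - (f a + f b)) \<bullet> w = 0" if "w \<in> W" for w
        using fo[OF that, of a] fo[OF that, of b] by (simp add: inner_diff_left inner_add_left)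
    qed
  next
    fix c a
    show "f (c *s a) = c *s f a"
    proof (rule funiq)
      show "c *s f a \<in> W" using W fW vec.subspace_scale by blast
      fix w assume "w \<in> W"
      then have "cnj c *s w \<in> W" using W vec.subspace_scale by blast
      then have "(c *s (a - f a)) \<bullet> w = 0" by (simp only: inner_smult_left fo)
      moreover have "c *s a - c *s f a = c *s (a - f a)"
        by (simp add: vec_eq_iff right_diff_distrib)
      ultimately show "(c *s a - c *s f a) \<bullet> w = 0"
        by (simp only:)
    qed
  qed
  define P where "P = matrix f"
  have P: "P *v a = f a" for a
    using matrix_works[OF lin] by (simp add: P_def)
  have ff: "f p = p" if "p \<in> W" for p
    using that by (rule funiq) simp
  have "P ** P = P"
    by (simp add: matrix_eq P ff fW flip: matrix_vector_mul_assoc)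
  moreover have "conj_transpose P = P"
  proof -
    have "(conj_transpose P *v a) \<bullet> b = (P *v a) \<bullet> b" for a b
    proof -
      have "(a - f a) \<bullet> f b = 0" "(b - f b) \<bullet> f a = 0" using fo fW by auto
      then have "a \<bullet> f b = f a \<bullet> f b" "b \<bullet> f a = f b \<bullet> f a"
        by (simp_all only: inner_diff_left right_minus_eq)
      then show ?thesis
        unfolding inner_conj_transpose P by (simp only: inner_commute)
    qed
    then have "conj_transpose P *v a = P *v a" for a
      by (metis vector_eq_rdot)
    then show ?thesis by (simp add: matrix_eq)
  qed
  moreover have "range ((*v) P) = W"
  proof (intro equalityI subsetI)
    fix p assume "p \<in> W"
    then have "p = P *v p" by (simp only: P ff)
    then show "p \<in> range ((*v) P)" by (rule range_eqI)
  qed (use fW in \<open>auto simp: P\<close>)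
  ultimately show ?thesis unfolding orth_projector_def by blast
qed

lemma orth_projector_proj:
  assumes "vec.subspace W"
  shows "orth_projector (proj W) W"
  unfolding proj_def using orth_projector_exists[OF assms] orth_projector_unique
  by (metis the_equality)

lemma linear_system_solution:
  fixes M :: "complex ^ 'n ^ 'n"
  assumes "invertible M"
  shows "M *v u = a *s y + b *s (M *v y) \<longleftrightarrow> u = a *s (matrix_inv M *v y) + b *s y"
proof -
  have "M ** matrix_inv M = mat 1 \<and> matrix_inv M ** M = mat 1"
    unfolding matrix_inv_def by (rule someI_ex) (use assms in \<open>simp add: invertible_def\<close>)
  then have inv: "M *v (matrix_inv M *v w) = w" "matrix_inv M *v (M *v w) = w" for w
    by (simp_all add: matrix_vector_mul_assoc)
  show ?thesis
  proof
    assume "M *v u = a *s y + b *s (M *v y)"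
    then have "matrix_inv M *v (M *v u) = matrix_inv M *v (a *s y + b *s (M *v y))" by simp
    then show "u = a *s (matrix_inv M *v y) + b *s y"
      by (simp add: inv vec.add vec.scale)
  next
    assume "u = a *s (matrix_inv M *v y) + b *s y"
    then show "M *v u = a *s y + b *s (M *v y)"
      by (simp add: inv vec.add vec.scale)
  qed
qed

end

theory Submission
  imports Defs
begin

text \<open>The expansion vector \<open>v\<close> is orthogonal to \<open>\<V>\<close>, so \<open>\<V>\<^sub>+\<close> is the orthogonal sum of \<open>\<V>\<close> and
  \<open>span {v}\<close>, and projecting away \<open>\<V>\<^sub>+\<close> can be done in two stages: \<open>x\<close> loses its component in
  \<open>\<V>\<close>, which leaves \<open>x\<^sub>\<bottom>\<close>, and \<open>x\<^sub>\<bottom>\<close> then loses its component along \<open>v\<close>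
  (\<open>residual_span_insert\<close>).  Each stage contributes its sine as a factor, which is the product
  formula (\<open>sin_angle_sub_span_insert\<close>).  The same formula holds for \<open>v'\<close>, and the common factor
  \<open>sin \<angle>(\<V>, x)\<close> cancels from the quotient.

  For the bounds, the sine of the angle between a line and a fixed vector is the distance from
  that vector to the line, relative to its length, so it moves by at most \<open>\<parallel>v' - v\<parallel>\<close> when the
  unit vector \<open>v\<close> spanning the line is replaced by the unit vector \<open>v'\<close>
  (\<open>sin_angle_perturb\<close>).  Normalising two vectors at most
  doubles their relative distance (\<open>norm_normalize_diff_le\<close>), hence
  \<open>\<parallel>v' - v\<parallel> \<le> 2 \<epsilon>\<close>; this is the origin of the factor 2 in \<open>\<tau>\<close>.  Dividing
  \<open>\<bar>sin \<angle>(v', x\<^sub>\<bottom>) - sin \<angle>(v, x\<^sub>\<bottom>)\<bar> \<le> 2 \<epsilon>\<close> by \<open>sin \<angle>(v, x\<^sub>\<bottom>)\<close> gives \<open>1 \<plusminus> \<tau>\<close>.\<close>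

section \<open>Orthogonal projections onto complex subspaces\<close>

lemma norm_vector_smult:
  fixes w :: "complex ^ 'n"
  shows "norm (c *s w) = cmod c * norm w"
  by (simp add: norm_vec_def norm_mult L2_set_right_distrib)

lemma proj_mem:
  assumes "vec.subspace W"
  shows "proj W *v w \<in> W"
  using orth_projector_proj[OF assms] unfolding orth_projector_def by blast

lemma proj_residual_orthogonal:
  assumes W: "vec.subspace W" and q: "q \<in> W"
  shows "(w - proj W *v w) \<bullet> q = 0"
proof -
  have P: "proj W ** proj W = proj W" "conj_transpose (proj W) = proj W"
    "range ((*v) (proj W)) = W"
    using orth_projector_proj[OF W] unfolding orth_projector_def by blast+
  obtain r where r: "q = proj W *v r" using P(3) q by blast
  have "(w - proj W *v w) \<bullet> q = (proj W *v (w - proj W *v w)) \<bullet> r"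
    using inner_conj_transpose[of "proj W" "w - proj W *v w" r] by (simp add: P(2) r)
  also have "proj W *v (w - proj W *v w) = 0"
    by (simp add: matrix_vector_mult_diff_distrib matrix_vector_mul_assoc P(1))
  finally show ?thesis by simp
qed

text \<open>Testing with the real product \<open>\<bullet>\<close> is enough: a complex subspace contains \<open>\<i> *s q\<close> together
  with \<open>q\<close>, so vanishing real products with all of it force vanishing Hermitian products.\<close>

lemma proj_eqI:
  assumes W: "vec.subspace W" and p: "p \<in> W"
    and orth: "\<And>q. q \<in> W \<Longrightarrow> (w - p) \<bullet> q = 0"
  shows "proj W *v w = p"
proof -
  have d: "proj W *v w - p \<in> W"
    using proj_mem[OF W] p W vec.subspace_diff by blast
  have "(proj W *v w - p) \<bullet> (proj W *v w - p)
      = (w - p) \<bullet> (proj W *v w - p) - (w - proj W *v w) \<bullet> (proj W *v w - p)"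
    by (simp add: inner_diff_left)
  also have "\<dots> = 0" using orth[OF d] proj_residual_orthogonal[OF W d] by simp
  finally show ?thesis by simp
qed

lemma norm_proj_residual_le:
  assumes W: "vec.subspace W" and q: "q \<in> W"
  shows "norm (w - proj W *v w) \<le> norm (w - q)"
proof -
  have d: "proj W *v w - q \<in> W"
    using proj_mem[OF W] q W vec.subspace_diff by blast
  have "(norm (w - q))\<^sup>2 = (norm ((w - proj W *v w) + (proj W *v w - q)))\<^sup>2"
    by simp
  also have "\<dots> = (norm (w - proj W *v w))\<^sup>2 + (norm (proj W *v w - q))\<^sup>2"
    by (rule norm_add_Pythagorean) (simp add: orthogonal_def proj_residual_orthogonal[OF W d])
  finally have "(norm (w - proj W *v w))\<^sup>2 \<le> (norm (w - q))\<^sup>2" by simp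
  then show ?thesis by (rule power2_le_imp_le) simp
qed

lemma norm_proj_le:
  assumes W: "vec.subspace W"
  shows "norm (proj W *v w) \<le> norm w"
proof -
  have "(norm w)\<^sup>2 = (norm ((w - proj W *v w) + proj W *v w))\<^sup>2" by simp
  also have "\<dots> = (norm (w - proj W *v w))\<^sup>2 + (norm (proj W *v w))\<^sup>2"
    by (rule norm_add_Pythagorean)
      (simp add: orthogonal_def proj_residual_orthogonal[OF W proj_mem[OF W]])
  finally have "(norm (proj W *v w))\<^sup>2 \<le> (norm w)\<^sup>2" by simp
  then show ?thesis by (rule power2_le_imp_le) simp
qed

section \<open>Expanding a subspace by an orthogonal vector\<close>

text \<open>The sum of the projection of \<open>w\<close> onto \<open>span S\<close> and the projection of the remainder onto the
  line of \<open>v\<close> lies in the expanded space.  What is left over is orthogonal to \<open>v\<close> by construction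
  and still orthogonal to \<open>span S\<close>, since the second stage only subtracts a multiple of \<open>v\<close>.\<close>

lemma residual_span_insert:
  fixes S :: "(complex ^ 'n) set"
  assumes orth: "\<And>q. q \<in> vec.span S \<Longrightarrow> v \<bullet> q = 0"
  shows "(mat 1 - proj (vec.span (insert v S))) *v w
    = (mat 1 - proj (vec.span {v})) *v ((mat 1 - proj (vec.span S)) *v w)"
proof -
  define r where "r = w - proj (vec.span S) *v w"
  define s where "s = proj (vec.span {v}) *v r"
  have sub: "vec.subspace (vec.span T)" for T :: "(complex ^ 'n) set"
    by (rule vec.subspace_span)
  have s_mem: "s \<in> vec.span {v}" unfolding s_def by (rule proj_mem[OF sub])
  then obtain c where c: "s = c *s v" by (auto simp: vec.span_singleton)
  have "proj (vec.span (insert v S)) *v w = proj (vec.span S) *v w + s"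
  proof (rule proj_eqI[OF sub])
    have "proj (vec.span S) *v w \<in> vec.span (insert v S)"
      using proj_mem[OF sub] vec.span_mono[of S "insert v S"] by blast
    moreover have "s \<in> vec.span (insert v S)"
      using s_mem vec.span_mono[of "{v}" "insert v S"] by blast
    ultimately show "proj (vec.span S) *v w + s \<in> vec.span (insert v S)"
      by (rule vec.span_add)
  next
    fix q assume "q \<in> vec.span (insert v S)"
    then obtain k where k: "q - k *s v \<in> vec.span S"
      by (auto simp: vec.span_insert)
    have kv: "k *s v \<in> vec.span {v}" by (auto simp: vec.span_singleton)
    \<comment> \<open>The real product is not complex bilinear: \<open>c\<close> moves to the other factor as \<open>cnj c\<close>.\<close>
    have "cnj c *s (q - k *s v) \<in> vec.span S" using k by (rule vec.span_scale)
    then have "s \<bullet> (q - k *s v) = 0"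
      unfolding c inner_smult_left by (rule orth)
    moreover have "r \<bullet> (q - k *s v) = 0"
      unfolding r_def by (rule proj_residual_orthogonal[OF sub k])
    moreover have "(r - s) \<bullet> (k *s v) = 0"
      unfolding s_def by (rule proj_residual_orthogonal[OF sub kv])
    ultimately have "(r - s) \<bullet> q = 0"
      by (simp add: inner_diff_left inner_diff_right)
    moreover have "w - (proj (vec.span S) *v w + s) = r - s" by (simp add: r_def)
    ultimately show "(w - (proj (vec.span S) *v w + s)) \<bullet> q = 0"
      by (simp only:)
  qed
  then show ?thesis
    by (simp add: matrix_vector_mult_diff_rdistrib r_def s_def)
qed

lemma sin_angle_sub_span_insert:
  fixes S :: "(complex ^ 'n) set"
  assumes "\<And>q. q \<in> vec.span S \<Longrightarrow> v \<bullet> q = 0"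
    and "(mat 1 - proj (vec.span S)) *v w \<noteq> 0"
  shows "sin_angle_sub (vec.span (insert v S)) w
    = sin_angle_sub (vec.span S) w * sin_angle v ((mat 1 - proj (vec.span S)) *v w)"
  using assms(2)
  by (simp add: sin_angle_def sin_angle_sub_def residual_span_insert[OF assms(1)])

section \<open>Perturbing the spanning vector\<close>

text \<open>If \<open>c *s a\<close> is the point of the line of \<open>a\<close> nearest to \<open>w\<close>, then \<open>c *s b\<close> is a point of the
  line of \<open>b\<close> whose distance from \<open>w\<close> is larger by at most \<open>cmod c * norm (a - b)\<close>, and
  \<open>cmod c \<le> norm w\<close> because \<open>a\<close> is a unit vector.\<close>

lemma sin_angle_le_add_norm_diff:
  fixes a b w :: "complex ^ 'n"
  assumes a: "norm a = 1" and w: "w \<noteq> 0"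
  shows "sin_angle b w \<le> sin_angle a w + norm (a - b)"
proof -
  have sub: "vec.subspace (vec.span {d})" for d :: "complex ^ 'n"
    by (rule vec.subspace_span)
  have "proj (vec.span {a}) *v w \<in> vec.span {a}" by (rule proj_mem[OF sub])
  then obtain c where c: "proj (vec.span {a}) *v w = c *s a"
    by (auto simp: vec.span_singleton)
  have c_le: "cmod c \<le> norm w"
    using norm_proj_le[OF sub, of a w] by (simp add: c norm_vector_smult a)
  have "norm (w - proj (vec.span {b}) *v w) \<le> norm (w - c *s b)"
    by (rule norm_proj_residual_le[OF sub]) (auto simp: vec.span_singleton)
  also have "w - c *s b = (w - c *s a) + c *s (a - b)"
    by (simp add: vec_eq_iff algebra_simps)
  also have "norm \<dots> \<le> norm (w - c *s a) + cmod c * norm (a - b)"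
    by (metis norm_triangle_ineq norm_vector_smult)
  also have "\<dots> \<le> norm (w - c *s a) + norm w * norm (a - b)"
    using c_le by (simp add: mult_right_mono)
  finally have "norm (w - proj (vec.span {b}) *v w)
      \<le> norm (w - proj (vec.span {a}) *v w) + norm w * norm (a - b)"
    by (simp only: c)
  then show ?thesis
    using w by (simp add: sin_angle_def sin_angle_sub_def matrix_vector_mult_diff_rdistrib
        field_simps)
qed

lemma sin_angle_perturb:
  fixes a b w :: "complex ^ 'n"
  assumes "norm a = 1" "norm b = 1" "w \<noteq> 0"
  shows "\<bar>sin_angle b w - sin_angle a w\<bar> \<le> norm (a - b)"
  using sin_angle_le_add_norm_diff[of a w b] sin_angle_le_add_norm_diff[of b w a] assms
  by (simp add: abs_le_iff norm_minus_commute)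

text \<open>Scaling both vectors by \<open>1 / norm a\<close> gives the relative distance; replacing \<open>b / norm a\<close> by
  \<open>b / norm b\<close> then costs \<open>\<bar>norm a - norm b\<bar> / norm a\<close>, which is at most the same amount.\<close>

lemma norm_normalize_diff_le:
  fixes a b :: "'a::real_normed_vector"
  assumes a: "a \<noteq> 0" and b: "b \<noteq> 0"
  shows "norm (a /\<^sub>R norm a - b /\<^sub>R norm b) \<le> 2 * (norm (b - a) / norm a)"
proof -
  have "a /\<^sub>R norm a - b /\<^sub>R norm b
      = (a - b) /\<^sub>R norm a + (inverse (norm a) - inverse (norm b)) *\<^sub>R b"
    by (simp add: algebra_simps)
  also have "norm \<dots> \<le> norm (a - b) / norm a + \<bar>inverse (norm a) - inverse (norm b)\<bar> * norm b"
    by (rule order.trans[OF norm_triangle_ineq]) (simp add: divide_inverse mult.commute)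
  also have "\<bar>inverse (norm a) - inverse (norm b)\<bar> * norm b
      = \<bar>(inverse (norm a) - inverse (norm b)) * norm b\<bar>"
    by (simp add: abs_mult)
  also have "(inverse (norm a) - inverse (norm b)) * norm b = (norm b - norm a) / norm a"
    using a b by (simp add: field_simps)
  also have "\<bar>(norm b - norm a) / norm a\<bar> \<le> norm (b - a) / norm a"
    using norm_triangle_ineq3[of b a] by (simp add: divide_right_mono)
  finally show ?thesis by (simp add: norm_minus_commute)
qed

section \<open>Exact and inexact expansion\<close>

theorem theorem4:
  fixes A B :: "complex ^ 'n ^ 'n"
    and \<sigma> \<nu> \<alpha>\<^sub>1 \<alpha>\<^sub>2 :: complex
    and lam :: "nat \<Rightarrow> complex"
    and V :: "complex ^ 'm ^ 'n"
    and z :: "complex ^ 'm"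
    and x y u u' v v' x_perp :: "complex ^ 'n"
    and \<V> \<V>_plus \<V>'_plus :: "(complex ^ 'n) set"
    and P :: "complex ^ 'n ^ 'n"
    and \<epsilon> \<tau> :: real
  assumes "eigenvalue_list A lam"
    and "0 < cmod (lam 1 - \<sigma>)"
    and "cmod (lam 1 - \<sigma>) < cmod (lam 2 - \<sigma>)"
    and "\<And>k. \<lbrakk>2 \<le> k; k < CARD('n)\<rbrakk> \<Longrightarrow> cmod (lam k - \<sigma>) \<le> cmod (lam (k + 1) - \<sigma>)"
    and "eigenpair A (lam 1) x" and "norm x = 1"
    and "B = matrix_inv (A - mat \<sigma>)"
    and "conj_transpose V ** V = mat 1" and "\<V> = vec.span (columns V)"
    and "P = proj \<V>"
    and "eigenpair (conj_transpose V ** A ** V) \<nu> z" and "norm z = 1"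
    and "y = V *v z"
    and "\<alpha>\<^sub>1 \<noteq> 0"
    and "(A - mat \<sigma>) *v u = \<alpha>\<^sub>1 *s y + \<alpha>\<^sub>2 *s ((A - mat \<sigma>) *v y)"
    and "u = \<alpha>\<^sub>1 *s (B *v y) + \<alpha>\<^sub>2 *s y"
    and "(mat 1 - P) *v u \<noteq> 0" and "(mat 1 - P) *v u' \<noteq> 0"
    and "v = ((mat 1 - P) *v u) /\<^sub>R norm ((mat 1 - P) *v u)"
    and "v' = ((mat 1 - P) *v u') /\<^sub>R norm ((mat 1 - P) *v u')"
    and "\<epsilon> = norm ((mat 1 - P) *v u' - (mat 1 - P) *v u) / norm ((mat 1 - P) *v u)"
    and "\<V>_plus = vec.span (columns V \<union> {v})"
    and "\<V>'_plus = vec.span (columns V \<union> {v'})"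
    and "x_perp = (mat 1 - P) *v x" and "x_perp \<noteq> 0"
    and "sin_angle v x_perp \<noteq> 0"
    and "\<tau> = 2 * \<epsilon> / sin_angle v x_perp"
  shows "sin_angle_sub \<V>_plus x = sin_angle_sub \<V> x * sin_angle v x_perp \<and>
    sin_angle_sub \<V>'_plus x / sin_angle_sub \<V>_plus x = sin_angle v' x_perp / sin_angle v x_perp \<and>
    (angle v' v < pi / 2 \<longrightarrow> \<tau> < 1 \<longrightarrow>
      1 - \<tau> \<le> sin_angle_sub \<V>'_plus x / sin_angle_sub \<V>_plus x \<and>
      sin_angle_sub \<V>'_plus x / sin_angle_sub \<V>_plus x \<le> 1 + \<tau>)"
proof -
  note uz = assms(17) and uz' = assms(18) and v = assms(19) and v' = assms(20)
    and eps = assms(21) and Vp = assms(22) and Vp' = assms(23)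
    and xp = assms(24) and xp0 = assms(25) and sin0 = assms(26) and tau = assms(27)
  define S where "S = columns V"
  have P: "P = proj (vec.span S)" and V: "\<V> = vec.span S"
    using assms(9,10) by (simp_all add: S_def)
  have orth: "(r *\<^sub>R ((mat 1 - P) *v w)) \<bullet> q = 0" if "q \<in> vec.span S" for r w q
    using proj_residual_orthogonal[OF vec.subspace_span that, of w]
    by (simp add: P matrix_vector_mult_diff_rdistrib)
  have v_orth: "v \<bullet> q = 0" and v'_orth: "v' \<bullet> q = 0" if "q \<in> vec.span S" for q
    unfolding v v' using that by (rule orth)+
  have xp': "x_perp = (mat 1 - proj (vec.span S)) *v x" using xp P by simp
  have prod: "sin_angle_sub \<V>_plus x = sin_angle_sub \<V> x * sin_angle v x_perp"
    using sin_angle_sub_span_insert[of S v x] v_orth xp0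
    by (simp add: Vp V xp' flip: S_def)
  have prod': "sin_angle_sub \<V>'_plus x = sin_angle_sub \<V> x * sin_angle v' x_perp"
    using sin_angle_sub_span_insert[of S v' x] v'_orth xp0
    by (simp add: Vp' V xp' flip: S_def)
  have "sin_angle_sub \<V> x \<noteq> 0"
    using xp0 \<open>norm x = 1\<close> by (auto simp: sin_angle_sub_def xp' V)
  then have ratio: "sin_angle_sub \<V>'_plus x / sin_angle_sub \<V>_plus x
      = sin_angle v' x_perp / sin_angle v x_perp"
    by (simp add: prod prod')
  have pos: "sin_angle v x_perp > 0"
    using sin0 by (simp add: sin_angle_def sin_angle_sub_def)
  have "norm v = 1" "norm v' = 1" using uz uz' by (simp_all add: v v')
  then have "\<bar>sin_angle v' x_perp - sin_angle v x_perp\<bar> \<le> norm (v - v')"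
    using xp0 by (rule sin_angle_perturb)
  also have "\<dots> \<le> 2 * \<epsilon>"
    unfolding v v' eps by (rule norm_normalize_diff_le[OF uz uz'])
  finally have "\<bar>(sin_angle v' x_perp - sin_angle v x_perp) / sin_angle v x_perp\<bar> \<le> \<tau>"
    using pos by (simp add: tau divide_right_mono)
  moreover have "(sin_angle v' x_perp - sin_angle v x_perp) / sin_angle v x_perp
      = sin_angle v' x_perp / sin_angle v x_perp - 1"
    using pos by (simp add: diff_divide_distrib)
  ultimately have "\<bar>sin_angle v' x_perp / sin_angle v x_perp - 1\<bar> \<le> \<tau>" by simp
  then have "1 - \<tau> \<le> sin_angle v' x_perp / sin_angle v x_perp"
    "sin_angle v' x_perp / sin_angle v x_perp \<le> 1 + \<tau>"
    by (simp_all add: abs_le_iff)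
  then show ?thesis using prod ratio by simp
qed

end
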